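(* Let $R$ be a commutative semiring and let $S$ be a multiplicatively closed subset of $R$. If $I$ is a quasi $S$-$n$-ideal of $R$, then there exists $s\in S$ such that $s\sqrt{I}\subseteq N(R)$.
   Context: All semirings are commutative with identity $1\neq 0$. A subset $S$ of $R$ is multiplicatively closed if $0\notin S$, $1\in S$, and $st\in S$ for all $s,t\in S$. For an ideal $I$, $\sqrt{I}=\{a\in R: a^n\in I \text{ for some } n\in\mathbb{N}\}$, and $N(R)=\sqrt{(0)}$ is the nilradical (the set of nilpotent elements). A proper ideal $I$ of $R$ with $I\cap S=\emptyset$ is a quasi $S$-$n$-ideal of $R$ if there exists a fixed element $s\in S$ such that, for all $a,b\in R$, $ab\in I$ implies $sa^2\in I$ or $sb\in N(R)$. *)

theory Defs
  imports Main
begin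

text \<open>Commutative semirings with identity \<open>1 \<noteq> 0\<close> (and absorbing \<open>0\<close>) are the types of
  class \<^class>\<open>comm_semiring_1\<close>.\<close>

definition mult_closed :: "'a::comm_semiring_1 set \<Rightarrow> bool" where
  "mult_closed S \<longleftrightarrow> 0 \<notin> S \<and> 1 \<in> S \<and> (\<forall>s\<in>S. \<forall>t\<in>S. s * t \<in> S)"

definition semiring_ideal :: "'a::comm_semiring_1 set \<Rightarrow> bool" where
  "semiring_ideal I \<longleftrightarrow>
     I \<noteq> {} \<and> (\<forall>a\<in>I. \<forall>b\<in>I. a + b \<in> I) \<and> (\<forall>r. \<forall>a\<in>I. r * a \<in> I)"

text \<open>Exponents are positive; for an ideal, also admitting exponent \<open>0\<close> gives the same set.\<close>

definition radical :: "'a::comm_semiring_1 set \<Rightarrow> 'a set" where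
  "radical I = {a. \<exists>n\<ge>1. a ^ n \<in> I}"

definition nilradical :: "'a::comm_semiring_1 set" where
  "nilradical = radical {0}"

definition quasi_S_n_ideal :: "'a::comm_semiring_1 set \<Rightarrow> 'a set \<Rightarrow> bool" where
  "quasi_S_n_ideal S I \<longleftrightarrow>
     semiring_ideal I \<and> I \<noteq> UNIV \<and> I \<inter> S = {} \<and>
     (\<exists>s\<in>S. \<forall>a b. a * b \<in> I \<longrightarrow> s * a\<^sup>2 \<in> I \<or> s * b \<in> nilradical)"

end

theory Submission imports Defs begin

text \<open>The condition on products, applied to the trivial factorization \<open>b = 1 * b\<close> of an
  element \<open>b \<in> I\<close>, leaves two alternatives: \<open>s \<in> I\<close>, which is excluded by \<open>I \<inter> S = {}\<close>, or
  \<open>s * b\<close> nilpotent. Hence \<open>s\<close> multiplies all of \<open>I\<close> into the nilradical. If now \<open>a ^ n \<in> I\<close>,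
  then \<open>s * a ^ n\<close> is nilpotent, and \<open>(s * a) ^ n\<close> is a multiple of it, so \<open>s * a\<close> is nilpotent
  as well. The multiplier \<open>s\<close> from the definition of a quasi \<open>S\<close>-\<open>n\<close>-ideal therefore serves for
  the whole radical.\<close>

lemma nilradical_iff: "a \<in> nilradical \<longleftrightarrow> (\<exists>n\<ge>1. a ^ n = 0)"
  by (simp add: nilradical_def radical_def)

text \<open>For \<open>n \<ge> 1\<close> the product \<open>s * a ^ n\<close> divides \<open>(s * a) ^ n\<close>, so a vanishing power of the
  former forces a vanishing power of the latter.\<close>

lemma mult_in_nilradical_if_mult_power:
  assumes "s * a ^ n \<in> nilradical" and "n \<ge> 1"
  shows "s * a \<in> nilradical"
proof -
  obtain k where k: "k \<ge> 1" "(s * a ^ n) ^ k = 0"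
    using assms(1) by (auto simp: nilradical_iff)
  have "s ^ n = s ^ (n - 1) * s"
    using assms(2) by (metis One_nat_def Suc_le_eq power_minus_mult)
  then have "(s * a) ^ n = s ^ (n - 1) * (s * a ^ n)"
    by (simp add: power_mult_distrib mult.assoc)
  then have "(s * a) ^ (n * k) = 0"
    using k(2) by (metis mult_zero_right power_mult power_mult_distrib)
  moreover have "n * k \<ge> 1"
    using assms(2) k(1) by simp
  ultimately show ?thesis
    unfolding nilradical_iff by blast
qed

theorem proposition2p4:
  fixes S I :: "'a::comm_semiring_1 set"
  assumes "mult_closed S"
    and "quasi_S_n_ideal S I"
  shows "\<exists>s\<in>S. (\<lambda>a. s * a) ` radical I \<subseteq> nilradical"
proof -
  obtain s where s: "s \<in> S" "s \<notin> I"
    and quasi: "\<And>a b. a * b \<in> I \<Longrightarrow> s * a\<^sup>2 \<in> I \<or> s * b \<in> nilradical"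
    using assms(2) unfolding quasi_S_n_ideal_def by blast
  have "s * b \<in> nilradical" if "b \<in> I" for b
    using quasi[of 1 b] that s(2) by simp
  then have "s * a \<in> nilradical" if "a \<in> radical I" for a
    using that mult_in_nilradical_if_mult_power by (auto simp: radical_def)
  with s(1) show ?thesis
    by blast
qed

end
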